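(* Let $(S_7,\cdot)$ be the three-element commutative monoid $\{0,a,1\}$ with identity $1$, zero $0$ and $a\cdot a=0$. The interval $[\mathsf{V}(\mathcal{P}^{+}(S_7,\cdot)),\mathsf{V}(\mathcal{P}(S_7,\cdot))]$ in the lattice of ai-semiring varieties, consisting of all subvarieties of $\mathsf{V}(\mathcal{P}(S_7,\cdot))$ that include $\mathsf{V}(\mathcal{P}^{+}(S_7,\cdot))$, contains $2^{\aleph_0}$ distinct varieties.
   Context: An ai-semiring is an algebra $(S,+,\cdot)$ with $(S,+)$ a commutative idempotent semigroup, $(S,\cdot)$ a semigroup, and multiplication distributing over addition on both sides. No constants are in the signature. For a semigroup $S$, $\mathcal{P}(S)$ is the ai-semiring of all subsets of $S$ (including $\emptyset$) with $A+B=A\cup B$ and $AB=\{ab\mid a\in A,b\in B\}$, and $\mathcal{P}^+(S)$ is its subsemiring of all nonempty subsets. $\mathsf{V}(A)$ is the variety generated by $A$. *)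

theory Defs
  imports "HOL-Library.Equipollence" "HOL-Library.Set_Algebras" "HOL-Library.Countable_Set"
    "HOL-Library.Countable"
begin

record 'a ais =
  carr :: "'a set"
  add_op :: "'a \<Rightarrow> 'a \<Rightarrow> 'a"
  mul_op :: "'a \<Rightarrow> 'a \<Rightarrow> 'a"

locale ai_semiring =
  fixes S :: "'a ais"
  assumes nonempty: "carr S \<noteq> {}"
    and add_closed: "\<lbrakk>x \<in> carr S; y \<in> carr S\<rbrakk> \<Longrightarrow> add_op S x y \<in> carr S"
    and mul_closed: "\<lbrakk>x \<in> carr S; y \<in> carr S\<rbrakk> \<Longrightarrow> mul_op S x y \<in> carr S"
    and add_assoc: "\<lbrakk>x \<in> carr S; y \<in> carr S; z \<in> carr S\<rbrakk> \<Longrightarrow>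
      add_op S (add_op S x y) z = add_op S x (add_op S y z)"
    and add_comm: "\<lbrakk>x \<in> carr S; y \<in> carr S\<rbrakk> \<Longrightarrow> add_op S x y = add_op S y x"
    and add_idem: "x \<in> carr S \<Longrightarrow> add_op S x x = x"
    and mul_assoc: "\<lbrakk>x \<in> carr S; y \<in> carr S; z \<in> carr S\<rbrakk> \<Longrightarrow>
      mul_op S (mul_op S x y) z = mul_op S x (mul_op S y z)"
    and distrib_left: "\<lbrakk>x \<in> carr S; y \<in> carr S; z \<in> carr S\<rbrakk> \<Longrightarrow>
      mul_op S x (add_op S y z) = add_op S (mul_op S x y) (mul_op S x z)"
    and distrib_right: "\<lbrakk>x \<in> carr S; y \<in> carr S; z \<in> carr S\<rbrakk> \<Longrightarrow>
      mul_op S (add_op S x y) z = add_op S (mul_op S x z) (mul_op S y z)"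

datatype trm = Var nat | Add trm trm | Mul trm trm

instance trm :: countable
  by countable_datatype

type_synonym identity = "trm \<times> trm"

primrec eval :: "'a ais \<Rightarrow> (nat \<Rightarrow> 'a) \<Rightarrow> trm \<Rightarrow> 'a" where
  "eval S \<phi> (Var i) = \<phi> i"
| "eval S \<phi> (Add s t) = add_op S (eval S \<phi> s) (eval S \<phi> t)"
| "eval S \<phi> (Mul s t) = mul_op S (eval S \<phi> s) (eval S \<phi> t)"

definition satisfies :: "'a ais \<Rightarrow> identity set \<Rightarrow> bool" where
  "satisfies S \<Sigma> \<longleftrightarrow>
     (\<forall>(s, t) \<in> \<Sigma>. \<forall>\<phi>. range \<phi> \<subseteq> carr S \<longrightarrow> eval S \<phi> s = eval S \<phi> t)"

text \<open>
  A variety is the class of all ai-semirings that satisfy some set of identities.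
  As HOL has no classes ranging over all types, the ai-semirings are those whose
  carrier lies in a fixed type \<open>'u\<close>. For infinite \<open>'u\<close> this loses nothing:
  by \<open>variety_of_subsetD\<close> below, inclusion (and hence equality) of the classes over
  \<open>'u\<close> amounts to inclusion (equality) of the classes over arbitrary types.
\<close>

definition variety_of :: "identity set \<Rightarrow> 'u ais set" where
  "variety_of \<Sigma> = {S. ai_semiring S \<and> satisfies S \<Sigma>}"

definition variety :: "'u ais set \<Rightarrow> bool" where
  "variety \<V> \<longleftrightarrow> (\<exists>\<Sigma>. \<V> = variety_of \<Sigma>)"

text \<open>
  The variety generated by \<open>A\<close> is the intersection of all varieties containing \<open>A\<close>.
  Since \<open>A\<close> need not live on the type \<open>'u\<close>, membership of \<open>A\<close> in the variety defined by
  \<open>\<Sigma>\<close> is expressed as \<open>satisfies A \<Sigma>\<close>.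
\<close>

definition generated_variety :: "'a ais \<Rightarrow> 'u ais set" where
  "generated_variety A = \<Inter> {variety_of \<Sigma> |\<Sigma>. satisfies A \<Sigma>}"

definition variety_interval :: "'u ais set \<Rightarrow> 'u ais set \<Rightarrow> 'u ais set set" where
  "variety_interval \<V> \<W> = {\<U>. variety \<U> \<and> \<V> \<subseteq> \<U> \<and> \<U> \<subseteq> \<W>}"

lemma satisfies_Union: "satisfies S (\<Union> X) \<longleftrightarrow> (\<forall>\<Sigma>\<in>X. satisfies S \<Sigma>)"
  unfolding satisfies_def by blast

lemma generated_variety_eq:
  "generated_variety A = variety_of (\<Union> {\<Sigma>. satisfies A \<Sigma>})"
proof -
  have "satisfies A {}" by (simp add: satisfies_def)
  then show ?thesis
    unfolding generated_variety_def variety_of_def satisfies_Union by blast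
qed

lemma variety_generated_variety: "variety (generated_variety A)"
  unfolding variety_def generated_variety_eq by blast

lemma generated_variety_least:
  assumes "ai_semiring A"
  shows "A \<in> generated_variety A"
    and "\<lbrakk>variety \<V>; A \<in> \<V>\<rbrakk> \<Longrightarrow> generated_variety A \<subseteq> \<V>"
  using assms unfolding generated_variety_def variety_def variety_of_def by auto

lemma variety_of_subsetD:
  fixes S :: "'a ais"
  assumes inf: "infinite (UNIV :: 'u set)"
    and sub: "(variety_of \<Sigma> :: 'u ais set) \<subseteq> variety_of \<Sigma>'"
    and S: "ai_semiring S" "satisfies S \<Sigma>"
  shows "satisfies S \<Sigma>'"
  unfolding satisfies_def
proof (intro ballI allI impI, clarify)
  fix s t and \<phi> :: "nat \<Rightarrow> 'a"
  assume st: "(s, t) \<in> \<Sigma>'" and \<phi>: "range \<phi> \<subseteq> carr S"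
  interpret ai_semiring S by fact
  define T where "T = range (eval S \<phi>)"
  have ev: "eval S \<phi> u \<in> carr S" for u
    using \<phi> by (induction u) (auto intro: add_closed mul_closed)
  have TS: "T \<subseteq> carr S" using ev by (auto simp: T_def)
  have T_add: "add_op S x y \<in> T" if xy: "x \<in> T" "y \<in> T" for x y
  proof -
    obtain u v where "x = eval S \<phi> u" "y = eval S \<phi> v" using xy by (auto simp: T_def)
    then have "add_op S x y = eval S \<phi> (Add u v)" by simp
    then show ?thesis unfolding T_def by blast
  qed
  have T_mul: "mul_op S x y \<in> T" if xy: "x \<in> T" "y \<in> T" for x y
  proof -
    obtain u v where "x = eval S \<phi> u" "y = eval S \<phi> v" using xy by (auto simp: T_def)
    then have "mul_op S x y = eval S \<phi> (Mul u v)" by simp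
    then show ?thesis unfolding T_def by blast
  qed
  have "countable T" unfolding T_def by simp
  moreover obtain h :: "nat \<Rightarrow> 'u" where h: "inj h"
    using infinite_countable_subset[OF inf] by blast
  ultimately obtain f :: "'a \<Rightarrow> 'u" where f: "inj_on f T"
    by (metis comp_inj_on inj_on_subset inj_on_to_nat_on subset_UNIV)
  define g where "g = inv_into T f"
  have gf: "g (f x) = x" if "x \<in> T" for x using f that by (simp add: g_def)
  define B where "B = \<lparr>carr = f ` T, add_op = (\<lambda>x y. f (add_op S (g x) (g y))),
     mul_op = (\<lambda>x y. f (mul_op S (g x) (g y)))\<rparr>"
  have B [simp]: "carr B = f ` T" "add_op B x y = f (add_op S (g x) (g y))"
     "mul_op B x y = f (mul_op S (g x) (g y))" for x y by (simp_all add: B_def)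
  have "ai_semiring B"
  proof
    show "carr B \<noteq> {}" by (simp add: T_def)
    fix x y
    assume "x \<in> carr B" "y \<in> carr B"
    then show "add_op B x y = add_op B y x" using TS by (auto simp: gf add_comm subset_iff)
  qed (use TS in \<open>auto simp: gf T_add T_mul subset_iff add_assoc mul_assoc add_idem
        distrib_left distrib_right\<close>)
  have evB: "eval B \<psi> u = f (eval S (g \<circ> \<psi>) u) \<and> eval S (g \<circ> \<psi>) u \<in> T"
    if "range \<psi> \<subseteq> f ` T" for \<psi> :: "nat \<Rightarrow> 'u" and u
  proof (induction u)
    case (Var i)
    have "\<psi> i \<in> f ` T" using that by blast
    then show ?case by (auto simp: gf)
  qed (simp_all add: gf T_add T_mul)
  have "satisfies B \<Sigma>"
    unfolding satisfies_def
  proof (intro ballI allI impI, clarify)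
    fix s t and \<psi> :: "nat \<Rightarrow> 'u"
    assume "(s, t) \<in> \<Sigma>" and \<psi>: "range \<psi> \<subseteq> carr B"
    moreover have "range (g \<circ> \<psi>) \<subseteq> carr S"
    proof clarify
      fix i
      have "\<psi> i \<in> f ` T" using \<psi> by auto
      then show "(g \<circ> \<psi>) i \<in> carr S" using TS by (auto simp: gf)
    qed
    ultimately have "eval S (g \<circ> \<psi>) s = eval S (g \<circ> \<psi>) t"
      using S(2) unfolding satisfies_def by blast
    then show "eval B \<psi> s = eval B \<psi> t" using evB \<psi> by simp
  qed
  then have "satisfies B \<Sigma>'"
    using sub \<open>ai_semiring B\<close> unfolding variety_of_def by blast
  moreover have \<phi>T: "\<phi> i \<in> T" for i
    unfolding T_def by (rule range_eqI[of _ _ "Var i"]) simp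
  then have rng: "range (f \<circ> \<phi>) \<subseteq> f ` T" by auto
  ultimately have "eval B (f \<circ> \<phi>) s = eval B (f \<circ> \<phi>) t"
    using st unfolding satisfies_def by auto
  moreover have "g \<circ> (f \<circ> \<phi>) = \<phi>" using gf \<phi>T by auto
  ultimately have "f (eval S \<phi> s) = f (eval S \<phi> t)" using evB[OF rng] by simp
  then show "eval S \<phi> s = eval S \<phi> t" using f by (simp add: T_def inj_on_eq_iff)
qed

text \<open>
  The product of two sets is the elementwise product provided by
  \<^theory>\<open>HOL-Library.Set_Algebras\<close>.
\<close>

definition power_semiring :: "'s::semigroup_mult set ais" where
  "power_semiring = \<lparr>carr = UNIV, add_op = (\<union>), mul_op = (*)\<rparr>"

definition nonempty_power_semiring :: "'s::semigroup_mult set ais" where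
  "nonempty_power_semiring = \<lparr>carr = {A. A \<noteq> {}}, add_op = (\<union>), mul_op = (*)\<rparr>"

lemma ai_semiring_power_semiring: "ai_semiring power_semiring"
  by unfold_locales (auto simp: power_semiring_def set_times_def mult.assoc; metis mult.assoc)+

lemma ai_semiring_nonempty_power_semiring: "ai_semiring nonempty_power_semiring"
  by unfold_locales
    (auto simp: nonempty_power_semiring_def set_times_def mult.assoc; metis mult.assoc)+

datatype s7 = S7_zero | S7_a | S7_one

instantiation s7 :: "{comm_monoid_mult, mult_zero}"
begin

definition zero_s7 :: s7 where "0 = S7_zero"

definition one_s7 :: s7 where "1 = S7_one"

fun times_s7 :: "s7 \<Rightarrow> s7 \<Rightarrow> s7" where
  "S7_one * y = y"
| "x * S7_one = x"
| "_ * _ = S7_zero"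

instance
proof
  fix x y z :: s7
  show "x * y * z = x * (y * z)" by (cases x; cases y; cases z; simp)
  show "x * y = y * x" by (cases x; cases y; simp)
  show "1 * x = x" by (simp add: one_s7_def)
  show "0 * x = 0" "x * 0 = 0" by (cases x; simp add: zero_s7_def)+
qed

end

lemma S7_a_times_S7_a: "S7_a * S7_a = 0"
  by (simp add: zero_s7_def)

end

theory Submission
  imports Defs "HOL-Library.Multiset"
begin

text \<open>
  Let \<open>\<sigma>\<^sub>N\<close> (with \<open>N \<ge> 2\<close>) be the identity \<open>p + x\<^sub>1\<cdots>x\<^sub>N \<approx> p\<close>, where
  \<open>p = x\<^sub>1 + \<dots> + x\<^sub>N + x\<^sub>1\<cdots>x\<^sub>N z + z z\<close>. It holds for nonempty subsets of \<open>S\<^sub>7\<close>, because a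
  product in \<open>S\<^sub>7\<close> is \<open>0\<close> or equal to one of its factors, and \<open>0\<close> is absorbed by any element of \<open>z\<close>.
  The \<open>\<sigma>\<^sub>N\<close> are independent modulo the identities of the full power semiring: let \<open>W\<close> be the set
  of the words \<open>w\<close> such that \<open>w \<le> p\<close> holds in the full power semiring. It does not
  contain \<open>x\<^sub>1\<cdots>x\<^sub>N\<close>, and its syntactic semiring satisfies every \<open>\<sigma>\<^sub>M\<close> with \<open>M \<noteq> N\<close>: a substitution
  that takes the left-hand side of \<open>\<sigma>\<^sub>M\<close> into \<open>W\<close>, but not \<open>x\<^sub>1\<cdots>x\<^sub>M\<close>, sends \<open>z\<close> to a power of
  \<open>z\<close> (because of \<open>z z\<close>), and so distributes the \<open>N\<close> letters \<open>x\<^sub>i\<close> bijectively over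
  the \<open>M\<close> variables.
\<close>

section \<open>Syntactic semirings\<close>

text \<open>In the application words are multisets, so concatenation is written \<open>+\<close>;
  letters commute because \<open>S_7\<close> is commutative.\<close>

definition set_semiring :: "'a::comm_monoid_add set ais" where
  "set_semiring = \<lparr>carr = {A. A \<noteq> {}}, add_op = (\<union>), mul_op = (+)\<rparr>"

definition contexts :: "'a::comm_monoid_add set \<Rightarrow> 'a set \<Rightarrow> 'a set" where
  "contexts W A = {u. \<forall>v\<in>A. u + v \<in> W}"

text \<open>
  A set of words is represented by its contexts; as \<^term>\<open>contexts W\<close> is a Galois connection
  with itself, \<^term>\<open>contexts W (contexts W A)\<close> is the largest set with the same contexts as \<open>A\<close>.
\<close>

definition syntactic_semiring :: "'a::comm_monoid_add set \<Rightarrow> 'a set ais" where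
  "syntactic_semiring W = \<lparr>carr = {contexts W A |A. A \<noteq> {}}, add_op = (\<inter>),
     mul_op = (\<lambda>X Y. contexts W (contexts W X + contexts W Y))\<rparr>"

lemma contexts_Un: "contexts W (A \<union> B) = contexts W A \<inter> contexts W B"
  by (auto simp: contexts_def)

lemma subset_closure: "A \<subseteq> contexts W (contexts W A)"
  by (auto simp: contexts_def) (metis add.commute)

lemma contexts_antimono: "A \<subseteq> B \<Longrightarrow> contexts W B \<subseteq> contexts W A"
  by (auto simp: contexts_def)

lemma contexts_contexts_contexts: "contexts W (contexts W (contexts W A)) = contexts W A"
  by (simp add: antisym contexts_antimono subset_closure)

text \<open>Moving \<open>b\<close> into the context shows that the contexts of \<open>A + B\<close>
  depend on \<open>A\<close> only through \<open>contexts W A\<close>; hence having the same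
  contexts is a congruence.\<close>

lemma in_contexts_plus: "u \<in> contexts W (A + B) \<longleftrightarrow> (\<forall>b\<in>B. u + b \<in> contexts W A)"
proof -
  have "u + b + a = u + (a + b)" for a b by (simp add: ac_simps)
  moreover have "u \<in> contexts W (A + B) \<longleftrightarrow> (\<forall>b\<in>B. \<forall>a\<in>A. u + (a + b) \<in> W)"
    by (auto simp: contexts_def set_plus_def)
  ultimately show ?thesis by (simp add: contexts_def)
qed

lemma contexts_closure_plus: "contexts W (contexts W (contexts W A) + B) = contexts W (A + B)"
  by (rule set_eqI) (simp add: in_contexts_plus contexts_contexts_contexts)

lemma contexts_closure_plus_closure:
  "contexts W (contexts W (contexts W A) + contexts W (contexts W B)) = contexts W (A + B)"
  using contexts_closure_plus[of W A "contexts W (contexts W B)"] contexts_closure_plus[of W B A]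
  by (simp add: add.commute)

text \<open>These equations make \<open>contexts W\<close> a homomorphism from
  \<open>set_semiring\<close>, so the axioms carry over and terms can be evaluated on
  representatives.\<close>

lemma syntactic_semiring_simps:
  "add_op (syntactic_semiring W) X Y = X \<inter> Y"
  "mul_op (syntactic_semiring W) (contexts W A) (contexts W B) = contexts W (A + B)"
  by (simp_all add: syntactic_semiring_def contexts_closure_plus_closure)

lemma carr_syntactic_semiring:
  "X \<in> carr (syntactic_semiring W) \<longleftrightarrow> (\<exists>A. A \<noteq> {} \<and> X = contexts W A)"
  by (auto simp: syntactic_semiring_def)

lemma set_plus_Un:
  fixes A B C :: "'a::comm_monoid_add set"
  shows "A + (B \<union> C) = (A + B) \<union> (A + C)" "(A \<union> B) + C = (A + C) \<union> (B + C)"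
  by (auto simp: set_plus_def)

lemma set_plus_nonempty:
  fixes A B :: "'a::comm_monoid_add set"
  shows "A \<noteq> {} \<Longrightarrow> B \<noteq> {} \<Longrightarrow> A + B \<noteq> {}"
  by (auto simp: set_plus_def)

lemma ai_semiring_syntactic_semiring: "ai_semiring (syntactic_semiring W)"
proof
  show "carr (syntactic_semiring W) \<noteq> {}" by (auto simp: syntactic_semiring_def)
next
  fix X Y
  assume "X \<in> carr (syntactic_semiring W)" "Y \<in> carr (syntactic_semiring W)"
  then obtain A B where "A \<noteq> {}" "B \<noteq> {}" "X = contexts W A" "Y = contexts W B"
    by (auto simp: carr_syntactic_semiring)
  then have "A \<union> B \<noteq> {}" "A + B \<noteq> {}"
    "add_op (syntactic_semiring W) X Y = contexts W (A \<union> B)"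
    "mul_op (syntactic_semiring W) X Y = contexts W (A + B)"
    by (simp_all add: set_plus_nonempty contexts_Un syntactic_semiring_simps)
  then show "add_op (syntactic_semiring W) X Y \<in> carr (syntactic_semiring W)"
    "mul_op (syntactic_semiring W) X Y \<in> carr (syntactic_semiring W)"
    unfolding carr_syntactic_semiring by blast+
qed (clarsimp simp: carr_syntactic_semiring syntactic_semiring_simps set_plus_Un Un_ac add.assoc
      simp flip: contexts_Un)+

lemma eval_syntactic_semiring:
  assumes "\<And>i. \<phi> i = contexts W (\<psi> i)"
  shows "eval (syntactic_semiring W) \<phi> t = contexts W (eval set_semiring \<psi> t)"
  by (induction t) (simp_all add: assms syntactic_semiring_simps set_semiring_def contexts_Un)

lemma satisfies_syntactic_semiring:
  "satisfies (syntactic_semiring W) \<Sigma> \<longleftrightarrow>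
     (\<forall>(s, t)\<in>\<Sigma>. \<forall>\<psi>. (\<forall>i. \<psi> i \<noteq> {}) \<longrightarrow>
        contexts W (eval set_semiring \<psi> s) = contexts W (eval set_semiring \<psi> t))"
    (is "?L \<longleftrightarrow> ?R")
proof
  assume L: ?L
  show ?R
  proof (clarify)
    fix s t and \<psi> :: "nat \<Rightarrow> 'a set"
    assume st: "(s, t) \<in> \<Sigma>" and \<psi>: "\<forall>i. \<psi> i \<noteq> {}"
    have "range (\<lambda>i. contexts W (\<psi> i)) \<subseteq> carr (syntactic_semiring W)"
      using \<psi> unfolding image_subset_iff carr_syntactic_semiring by blast
    with L st have "eval (syntactic_semiring W) (\<lambda>i. contexts W (\<psi> i)) s =
        eval (syntactic_semiring W) (\<lambda>i. contexts W (\<psi> i)) t"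
      unfolding satisfies_def by blast
    then show "contexts W (eval set_semiring \<psi> s) = contexts W (eval set_semiring \<psi> t)"
      by (simp add: eval_syntactic_semiring)
  qed
next
  assume R: ?R
  show ?L
    unfolding satisfies_def
  proof (clarify)
    fix s t and \<phi> :: "nat \<Rightarrow> 'a set"
    assume st: "(s, t) \<in> \<Sigma>" and "range \<phi> \<subseteq> carr (syntactic_semiring W)"
    then have "\<forall>i. \<exists>A. A \<noteq> {} \<and> \<phi> i = contexts W A"
      by (auto simp: image_subset_iff carr_syntactic_semiring)
    then obtain \<psi> where \<psi>: "\<And>i. \<psi> i \<noteq> {}" "\<And>i. \<phi> i = contexts W (\<psi> i)" by metis
    from bspec[OF R st]
    have "contexts W (eval set_semiring \<psi> s) = contexts W (eval set_semiring \<psi> t)"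
      using \<psi>(1) by simp
    then show "eval (syntactic_semiring W) \<phi> s = eval (syntactic_semiring W) \<phi> t"
      by (simp add: eval_syntactic_semiring[OF \<psi>(2)])
  qed
qed

section \<open>Identities inherited from the full power semiring\<close>

definition word_value :: "('x \<Rightarrow> 's::comm_monoid_mult set) \<Rightarrow> 'x multiset \<Rightarrow> 's set" where
  "word_value \<rho> w = (\<Prod>x\<in>#w. \<rho> x)"

lemma word_value_plus: "word_value \<rho> (u + v) = word_value \<rho> u * word_value \<rho> v"
  by (simp add: word_value_def)

lemma UN_word_value_plus:
  "(\<Union>w\<in>A + B. word_value \<rho> w) = (\<Union>w\<in>A. word_value \<rho> w) * (\<Union>w\<in>B. word_value \<rho> w)"
  by (fastforce simp: set_plus_def set_times_def word_value_plus)

text \<open>Collecting the values of all words in a set is a homomorphism into the power semiring,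
  so it commutes with evaluation.\<close>

lemma eval_power_semiring_word_value:
  "eval power_semiring (\<lambda>i. \<Union>w\<in>\<psi> i. word_value \<rho> w) t =
     (\<Union>w\<in>eval set_semiring \<psi> t. word_value \<rho> w)"
  by (induction t) (simp_all add: power_semiring_def set_semiring_def UN_word_value_plus)

text \<open>By \<open>sep\<close>, a word outside \<open>W\<close> takes a value that no word of
  \<open>W\<close> takes under the same assignment. Both sides of an identity have the same values
  under all assignments, so a context that sends one side into \<open>W\<close> does so for the
  other.\<close>

lemma syntactic_semiring_satisfies_power_identities:
  fixes W :: "'x multiset set"
  assumes sep: "\<And>w. w \<notin> W \<Longrightarrow> \<exists>(\<rho> :: 'x \<Rightarrow> 's::comm_monoid_mult set) e.
      e \<in> word_value \<rho> w \<and> (\<forall>w'\<in>W. e \<notin> word_value \<rho> w')"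
    and sat: "satisfies (power_semiring :: 's set ais) \<Sigma>"
  shows "satisfies (syntactic_semiring W) \<Sigma>"
  unfolding satisfies_syntactic_semiring
proof (clarify)
  fix s t and \<psi> :: "nat \<Rightarrow> 'x multiset set"
  assume st: "(s, t) \<in> \<Sigma>"
  have ev: "(\<Union>w\<in>eval set_semiring \<psi> s. word_value \<rho> w) =
      (\<Union>w\<in>eval set_semiring \<psi> t. word_value \<rho> w)" for \<rho> :: "'x \<Rightarrow> 's set"
    unfolding eval_power_semiring_word_value[symmetric]
    using sat st by (auto simp: satisfies_def power_semiring_def)
  have sub: "contexts W A \<subseteq> contexts W B"
    if AB: "\<And>\<rho> :: 'x \<Rightarrow> 's set. (\<Union>w\<in>A. word_value \<rho> w) = (\<Union>w\<in>B. word_value \<rho> w)" for A B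
  proof
    fix u
    assume u: "u \<in> contexts W A"
    have "u + v \<in> W" if "v \<in> B" for v
    proof (rule ccontr)
      assume "u + v \<notin> W"
      then obtain \<rho> :: "'x \<Rightarrow> 's set" and e
        where e: "e \<in> word_value \<rho> (u + v)" "\<forall>w'\<in>W. e \<notin> word_value \<rho> w'"
        using sep by blast
      then obtain c d where cd: "e = c * d" "c \<in> word_value \<rho> u" "d \<in> word_value \<rho> v"
        by (auto simp: word_value_plus set_times_def)
      \<comment> \<open>As \<open>A\<close> and \<open>B\<close> have the same values,
        \<open>d\<close> is also a value of a word of \<open>A\<close>, which brings the excluded
        value \<open>e\<close> into \<open>W\<close>.\<close>
      then obtain v' where v': "v' \<in> A" "d \<in> word_value \<rho> v'"
        using AB[of \<rho>] \<open>v \<in> B\<close> by blast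
      then have "e \<in> word_value \<rho> (u + v')"
        using cd by (auto simp: word_value_plus set_times_def)
      then show False using e(2) u v'(1) by (auto simp: contexts_def)
    qed
    then show "u \<in> contexts W B" by (simp add: contexts_def)
  qed
  show "contexts W (eval set_semiring \<psi> s) = contexts W (eval set_semiring \<psi> t)"
    using sub[OF ev] sub[OF ev[symmetric]] by blast
qed

section \<open>The identities\<close>

text \<open>The recursion starts with two variables, so index \<open>n\<close> covers the variables
  1 to \<open>n + 2\<close>; variable 0 is reserved for \<open>z\<close>.\<close>

primrec sum_term :: "nat \<Rightarrow> trm" where
  "sum_term 0 = Add (Var 1) (Var 2)"
| "sum_term (Suc n) = Add (sum_term n) (Var (n + 3))"

primrec prod_term :: "nat \<Rightarrow> trm" where
  "prod_term 0 = Mul (Var 1) (Var 2)"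
| "prod_term (Suc n) = Mul (prod_term n) (Var (n + 3))"

definition lower_term :: "nat \<Rightarrow> trm" where
  "lower_term n =
     Add (sum_term n) (Add (Mul (prod_term n) (Var 0)) (Mul (Var 0) (Var 0)))"

text \<open>The identity \<open>\<sigma>\<^sub>N\<close> for \<open>N = n + 2\<close>, with \<open>z\<close> as variable 0.\<close>

definition sigma :: "nat \<Rightarrow> identity" where
  "sigma n = (Add (lower_term n) (prod_term n), lower_term n)"

lemma s7_mult_cases: "x * y = 0 \<or> x * y = x \<or> x * y = (y :: s7)"
  by (cases x; cases y) (simp_all add: zero_s7_def)

lemma eval_prod_term_s7:
  "eval nonempty_power_semiring \<phi> (prod_term n) \<subseteq>
     insert (0::s7) (eval nonempty_power_semiring \<phi> (sum_term n))"
proof (induction n)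
  case 0
  show ?case
    using s7_mult_cases by (fastforce simp: nonempty_power_semiring_def set_times_def)
next
  case (Suc n)
  show ?case
  proof
    fix e
    assume "e \<in> eval nonempty_power_semiring \<phi> (prod_term (Suc n))"
    then obtain x y where xy: "e = x * y" "y \<in> \<phi> (n + 3)"
        "x \<in> eval nonempty_power_semiring \<phi> (prod_term n)"
      by (auto simp: nonempty_power_semiring_def set_times_def)
    then show "e \<in> insert 0 (eval nonempty_power_semiring \<phi> (sum_term (Suc n)))"
      using Suc s7_mult_cases[of x y] by (auto simp: nonempty_power_semiring_def)
  qed
qed

lemma nonempty_power_semiring_satisfies_sigma:
  "satisfies (nonempty_power_semiring :: s7 set ais) {sigma n}"
  unfolding satisfies_def sigma_def
proof (clarify)
  fix \<phi> :: "nat \<Rightarrow> s7 set"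
  let ?ev = "eval nonempty_power_semiring \<phi>"
  assume rng: "range \<phi> \<subseteq> carr nonempty_power_semiring"
  have "\<phi> 0 \<in> carr nonempty_power_semiring" using rng by blast
  then obtain t where t: "t \<in> \<phi> 0" by (auto simp: nonempty_power_semiring_def)
  have "?ev (prod_term n) \<subseteq> ?ev (lower_term n)"
  proof
    fix e
    assume e: "e \<in> ?ev (prod_term n)"
    show "e \<in> ?ev (lower_term n)"
    proof (cases "e = 0")
      case True
      \<comment> \<open>Here \<open>e * t\<close> is again \<open>0\<close>; the nonemptiness of
        \<open>\<phi> 0\<close> enters through \<open>t\<close>.\<close>
      have "e * t \<in> ?ev (prod_term n) * \<phi> 0" using e t by (rule set_times_intro)
      then show ?thesis using True by (simp add: lower_term_def nonempty_power_semiring_def)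
    next
      case False
      then have "e \<in> ?ev (sum_term n)" using e eval_prod_term_s7 by blast
      then show ?thesis by (simp add: lower_term_def nonempty_power_semiring_def)
    qed
  qed
  then have "?ev (lower_term n) \<union> ?ev (prod_term n) = ?ev (lower_term n)" by blast
  then show "?ev (Add (lower_term n) (prod_term n)) = ?ev (lower_term n)"
    by (simp add: nonempty_power_semiring_def)
qed

lemma variables_interval: "{1..0 + 2} = {1, 2::nat}" "{1..Suc n + 2} = insert (n + 3) {1..n + 2}"
  by auto

lemma eval_sum_term:
  "eval set_semiring \<psi> (sum_term n) = (\<Union>i\<in>{1..n + 2}. \<psi> i)"
  by (induction n; simp only: variables_interval) (auto simp: set_semiring_def)

lemma eval_prod_term:
  "eval set_semiring \<psi> (prod_term n) =
     {\<Sum>i\<in>{1..n + 2}. v i |v. \<forall>i\<in>{1..n + 2}. v i \<in> \<psi> i}"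
proof (induction n)
  case 0
  have "w \<in> \<psi> 1 + \<psi> 2 \<longleftrightarrow> (\<exists>v :: nat \<Rightarrow> _. w = v 1 + v 2 \<and> v 1 \<in> \<psi> 1 \<and> v 2 \<in> \<psi> 2)" (is "?L \<longleftrightarrow> ?R") for w
  proof
    assume ?L
    then obtain x y where "w = x + y" "x \<in> \<psi> 1" "y \<in> \<psi> 2"
      by (rule set_plus_elim)
    then show ?R
      by (intro exI[of _ "\<lambda>i. if i = 1 then x else y"]) simp
  qed auto
  then show ?case unfolding variables_interval by (auto simp: set_semiring_def)
next
  case (Suc n)
  let ?I = "{1..n + 2}"
  have "w \<in> eval set_semiring \<psi> (prod_term n) + \<psi> (n + 3) \<longleftrightarrow>
      (\<exists>v. w = v (n + 3) + (\<Sum>i\<in>?I. v i) \<and> v (n + 3) \<in> \<psi> (n + 3) \<and> (\<forall>i\<in>?I. v i \<in> \<psi> i))"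
    (is "?L \<longleftrightarrow> ?R") for w
  proof
    assume ?L
    then obtain x y where xy: "w = x + y" "x \<in> eval set_semiring \<psi> (prod_term n)" "y \<in> \<psi> (n + 3)"
      by (rule set_plus_elim)
    then obtain v where v: "x = (\<Sum>i\<in>?I. v i)" "\<forall>i\<in>?I. v i \<in> \<psi> i"
      using Suc by auto
    \<comment> \<open>The update extends the choice to the new variable and leaves the values on
      \<open>?I\<close> alone.\<close>
    have "(\<Sum>i\<in>?I. (v(n + 3 := y)) i) = x"
      unfolding v(1) by (rule sum.cong) auto
    then have "w = (v(n + 3 := y)) (n + 3) + (\<Sum>i\<in>?I. (v(n + 3 := y)) i)"
      using xy(1) by (simp only: fun_upd_same add.commute)
    moreover have "\<forall>i\<in>?I. (v(n + 3 := y)) i \<in> \<psi> i" using v(2) by simp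
    ultimately show ?R using xy(3) fun_upd_same by metis
  next
    assume ?R
    then obtain v where v: "w = (\<Sum>i\<in>?I. v i) + v (n + 3)" "v (n + 3) \<in> \<psi> (n + 3)"
      "\<forall>i\<in>?I. v i \<in> \<psi> i"
      using add.commute by metis
    then have "(\<Sum>i\<in>?I. v i) \<in> eval set_semiring \<psi> (prod_term n)"
      unfolding Suc by blast
    then show ?L using v by (simp only: set_plus_intro)
  qed
  moreover have "n + 3 \<notin> ?I" by simp
  ultimately show ?case unfolding variables_interval by (auto simp: set_semiring_def)
qed

lemma eval_lower_term:
  "eval set_semiring \<psi> (lower_term n) =
     (\<Union>i\<in>{1..n + 2}. \<psi> i) \<union> (eval set_semiring \<psi> (prod_term n) + \<psi> 0 \<union> (\<psi> 0 + \<psi> 0))"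
  unfolding lower_term_def eval.simps eval_sum_term by (simp add: set_semiring_def)

section \<open>Independence\<close>

definition letters :: "nat \<Rightarrow> nat multiset" where
  "letters n = mset_set {1..n + 2}"

definition nonzero :: "nat multiset \<Rightarrow> nat multiset" where
  "nonzero w = {#x \<in># w. x \<noteq> 0#}"

text \<open>The set \<open>W\<close> in explicit form, with letter \<open>0\<close> as
  \<open>z\<close> and \<open>N = n + 2\<close>: the words \<open>x_i\<close>, the words
  \<open>z^k\<close> and \<open>x_i z^k\<close> with \<open>k \<ge> 2\<close>, and
  \<open>x_1...x_N z^k\<close> with \<open>k \<ge> 1\<close>.\<close>

definition lower_words :: "nat \<Rightarrow> nat multiset set" where
  "lower_words n = {w. nonzero w \<subseteq># letters n \<and>
     (size (nonzero w) = 1 \<and> count w 0 = 0 \<or>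
      size (nonzero w) \<le> 1 \<and> count w 0 \<ge> 2 \<or>
      size (nonzero w) = n + 2 \<and> count w 0 \<ge> 1)}"

lemma size_letters: "size (letters n) = n + 2"
  by (simp add: letters_def)

lemma count_letters: "count (letters n) i = (if i \<in> {1..n + 2} then 1 else 0)"
  by (simp add: letters_def)

lemma nonzero_plus: "nonzero (u + v) = nonzero u + nonzero v"
  by (simp add: nonzero_def)

lemma size_nonzero_sum: "size (nonzero (\<Sum>i\<in>A. v i)) = (\<Sum>i\<in>A. size (nonzero (v i)))"
  by (induction A rule: infinite_finite_induct) (simp_all add: nonzero_plus, simp_all add: nonzero_def)

lemma count_sum_mset: "count (\<Sum>i\<in>A. v i) x = (\<Sum>i\<in>A. count (v i) x)"
  by (induction A rule: infinite_finite_induct) simp_all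

lemma letters_eq_sum: "letters n = (\<Sum>i=1..n + 2. {#i#})"
  by (rule multiset_eqI) (simp add: letters_def count_sum_mset)

text \<open>The empty set erases every word that uses a letter outside \<open>L\<close>, so only
  words over \<open>L\<close> need to be separated. Only the full power semiring offers such
  assignments.\<close>

lemma word_value_partial:
  "word_value (\<lambda>x. if x \<in> L then {f x} else {}) w =
     (if set_mset w \<subseteq> L then {\<Prod>x\<in>#w. f x} else {})"
  by (induction w) (auto simp: word_value_def set_times_def set_one)

lemma prod_mset_if_one:
  "(\<Prod>x\<in>#w. if P x then b else 1) = (b :: 's::comm_monoid_mult) ^ size {#x \<in># w. P x#}"
  by (induction w) (simp_all add: mult_ac)

lemma s7_power_zero: "k > 0 \<Longrightarrow> (0::s7) ^ k = 0"
  by (cases k) simp_all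

text \<open>Powers of \<open>S7_a\<close> tell apart no, one, and at least two occurrences.\<close>

lemma s7_power_a: "S7_a ^ k = (if k = 0 then 1 else if k = 1 then S7_a else 0)"
proof (induction k)
  case (Suc k)
  then show ?case
    by (auto simp: S7_a_times_S7_a) (simp add: zero_s7_def)
qed simp

lemma s7_distinct: "S7_a \<noteq> 0" "S7_a \<noteq> 1" "(0::s7) \<noteq> 1" "1 \<noteq> S7_a" "0 \<noteq> S7_a" "(1::s7) \<noteq> 0"
  by (simp_all add: zero_s7_def one_s7_def)

lemma s7_power_a_eq_0_iff: "S7_a ^ k = 0 \<longleftrightarrow> k \<ge> 2"
  unfolding s7_power_a using s7_distinct by simp

text \<open>Erasing the missing letter keeps \<open>w\<close> but removes all full words from
  \<open>lower_words n\<close>.\<close>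

lemma missing_letter:
  assumes "nonzero w \<subseteq># letters n" "size (nonzero w) \<noteq> n + 2"
  obtains i where "i \<in> {1..n + 2}" "i \<notin># w"
proof -
  have "\<not> letters n \<subseteq># nonzero w"
    using assms size_letters subset_mset.antisym by metis
  then obtain i where "count (nonzero w) i < count (letters n) i"
    by (auto simp: subseteq_mset_def not_le)
  then have "i \<in> {1..n + 2}" "i \<notin># w"
    by (auto simp: count_letters nonzero_def not_in_iff split: if_splits)
  then show ?thesis by (rule that)
qed

lemma letter_in_full_word:
  assumes "nonzero w \<subseteq># letters n" "size (nonzero w) = n + 2" "i \<in> {1..n + 2}"
  shows "i \<in># w"
proof -
  have "nonzero w = letters n"
    using assms size_letters by (metis mset_subset_size nless_le subset_mset.le_less)
  then have "i \<in># nonzero w" using assms(3) by (simp add: letters_def)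
  then show ?thesis by (simp add: nonzero_def)
qed

text \<open>This provides \<open>sep\<close> for \<open>W\<close>: either some letter other than
  \<open>z\<close> occurs too often in \<open>w\<close>, or the numbers of \<open>z\<close> and of
  the other letters form a forbidden combination.\<close>

lemma lower_words_separated:
  assumes w: "w \<notin> lower_words n"
  shows "\<exists>(\<rho> :: nat \<Rightarrow> s7 set) e. e \<in> word_value \<rho> w \<and> (\<forall>w'\<in>lower_words n. e \<notin> word_value \<rho> w')"
proof -
  have sep: ?thesis
    if "set_mset w \<subseteq> L" "(\<Prod>x\<in>#w. f x) = e"
      "\<And>w'. w' \<in> lower_words n \<Longrightarrow> set_mset w' \<subseteq> L \<Longrightarrow> (\<Prod>x\<in>#w'. f x) \<noteq> e"
    for L and f :: "nat \<Rightarrow> s7" and e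
  proof -
    let ?\<rho> = "\<lambda>x. if x \<in> L then {f x} else {}"
    have "e \<in> word_value ?\<rho> w" "\<forall>w'\<in>lower_words n. e \<notin> word_value ?\<rho> w'"
      using that(1,2) that(3)[symmetric] unfolding word_value_partial by simp_all
    then show ?thesis by blast
  qed
  show ?thesis
  proof (cases "nonzero w \<subseteq># letters n")
    case False
    then obtain i where i: "count (nonzero w) i > count (letters n) i"
      by (auto simp: subseteq_mset_def not_le)
    then have i0: "i \<noteq> 0" "count w i > count (letters n) i"
      by (auto simp: nonzero_def split: if_splits)
    have le: "count w' i \<le> count (letters n) i" if "w' \<in> lower_words n" for w'
    proof -
      have "count (nonzero w') i \<le> count (letters n) i"
        using that by (auto simp: lower_words_def intro: mset_subset_eq_count)
      then show ?thesis using i0 by (simp add: nonzero_def)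
    qed
    have prod: "(\<Prod>x\<in>#w'. if x = i then b else 1) = b ^ count w' i" for w' and b :: s7
      by (simp add: prod_mset_if_one filter_eq_replicate_mset)
    show ?thesis
    proof (cases "i \<in> {1..n + 2}")
      case True
      then have "count (letters n) i = 1" by (simp add: count_letters)
      then have "count w i \<noteq> 0" "count w i \<noteq> 1"
        and "\<And>w'. w' \<in> lower_words n \<Longrightarrow> count w' i = 0 \<or> count w' i = 1"
        using i0 le by (auto simp: le_Suc_eq simp del: count_eq_zero_iff)
      \<comment> \<open>The letter \<open>i\<close> occurs at least twice in \<open>w\<close> and at
        most once in each word of \<open>W\<close>, so the value \<open>0\<close> separates
        them.\<close>
      then show ?thesis
        by (intro sep[of UNIV "\<lambda>x. if x = i then S7_a else 1" 0])
          (unfold prod s7_power_a, auto simp del: count_eq_zero_iff count_greater_zero_iff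
            simp: s7_distinct)
    next
      case False
      then have "count (letters n) i = 0" unfolding count_letters by simp
      then have "count w i > 0" and "\<And>w'. w' \<in> lower_words n \<Longrightarrow> count w' i = 0"
        using i0 le by (auto simp del: count_eq_zero_iff count_greater_zero_iff)
      \<comment> \<open>No word of \<open>W\<close> contains \<open>i\<close>, so all of them get
        the value \<open>1\<close>, while \<open>w\<close> is absorbed into
        \<open>0\<close>.\<close>
      then show ?thesis
        by (intro sep[of UNIV "\<lambda>x. if x = i then 0 else 1" 0])
          (unfold prod, auto simp del: count_eq_zero_iff count_greater_zero_iff
            simp: s7_power_zero s7_distinct)
    qed
  next
    case sub: True
    have nz: "size {#x \<in># w'. x \<noteq> 0#} = size (nonzero w')" for w' by (simp add: nonzero_def)
    have z: "size {#x \<in># w'. x = 0#} = count w' 0" for w' :: "nat multiset"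
      by (simp add: filter_eq_replicate_mset)
    have "\<not> (size (nonzero w) = 1 \<and> count w 0 = 0)"
      "\<not> (size (nonzero w) \<le> 1 \<and> count w 0 \<ge> 2)"
      "\<not> (size (nonzero w) = n + 2 \<and> count w 0 \<ge> 1)"
      using w sub unfolding lower_words_def by blast+
    then consider "size (nonzero w) = 0" "count w 0 = 0"
      | "count w 0 = 0" "size (nonzero w) \<ge> 2"
      | "count w 0 = 1" "size (nonzero w) \<noteq> n + 2"
      | "size (nonzero w) \<ge> 2" "size (nonzero w) \<noteq> n + 2"
      by linarith
    then show ?thesis
    proof cases
      case 1
      then have "w = {#}" by (auto simp: nonzero_def multiset_eq_iff) (metis gr0I)
      \<comment> \<open>With all letters erased only the empty word has a value, and it is not in
        \<open>W\<close>.\<close>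
      then show ?thesis
        by (intro sep[of "{}" "\<lambda>_. 1" 1]) (auto simp: lower_words_def nonzero_def)
    next
      case 2
      show ?thesis
      \<comment> \<open>The words of \<open>W\<close> without \<open>z\<close> are single letters,
        with value \<open>S7_a\<close>; \<open>w\<close> has at least two letters.\<close>
      proof (rule sep[of "- {0}" "\<lambda>x. if x \<noteq> 0 then S7_a else 1" 0])
        show "set_mset w \<subseteq> - {0}" using 2 by (auto simp: not_in_iff)
        show "(\<Prod>x\<in>#w. if x \<noteq> 0 then S7_a else 1) = 0"
          unfolding prod_mset_if_one nz s7_power_a_eq_0_iff using 2 by simp
      next
        fix w'
        assume w': "w' \<in> lower_words n" "set_mset w' \<subseteq> - {0}"
        then have "0 \<notin># w'" by auto
        then have "count w' 0 = 0" by (simp add: not_in_iff)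
        then have "size (nonzero w') = 1"
          using w'(1) unfolding lower_words_def mem_Collect_eq by linarith
        then show "(\<Prod>x\<in>#w'. if x \<noteq> 0 then S7_a else 1) \<noteq> 0"
          unfolding prod_mset_if_one nz by (simp add: s7_power_a s7_distinct)
      qed
    next
      case 3
      then obtain i where i: "i \<in> {1..n + 2}" "i \<notin># w" using missing_letter[OF sub] by blast
      show ?thesis
      \<comment> \<open>The words of \<open>W\<close> that survive are not full, so they contain
        \<open>z\<close> never or at least twice; \<open>w\<close> contains it once.\<close>
      proof (rule sep[of "- {i}" "\<lambda>x. if x = 0 then S7_a else 1" S7_a])
        show "set_mset w \<subseteq> - {i}" using i by auto
        show "(\<Prod>x\<in>#w. if x = 0 then S7_a else 1) = S7_a"
          unfolding prod_mset_if_one z using 3 by (simp add: s7_power_a)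
      next
        fix w'
        assume w': "w' \<in> lower_words n" "set_mset w' \<subseteq> - {i}"
        then have "size (nonzero w') \<noteq> n + 2"
          using letter_in_full_word[OF _ _ i(1), of w'] unfolding lower_words_def by blast
        then have "count w' 0 \<noteq> 1"
          using w'(1) unfolding lower_words_def mem_Collect_eq by linarith
        then show "(\<Prod>x\<in>#w'. if x = 0 then S7_a else 1) \<noteq> S7_a"
          unfolding prod_mset_if_one z by (simp add: s7_power_a s7_distinct)
      qed
    next
      case 4
      then obtain i where i: "i \<in> {1..n + 2}" "i \<notin># w" using missing_letter[OF sub] by blast
      show ?thesis
      \<comment> \<open>The words of \<open>W\<close> that survive have at most one letter other
        than \<open>z\<close>; \<open>w\<close> has at least two.\<close>
      proof (rule sep[of "- {i}" "\<lambda>x. if x \<noteq> 0 then S7_a else 1" 0])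
        show "set_mset w \<subseteq> - {i}" using i by auto
        show "(\<Prod>x\<in>#w. if x \<noteq> 0 then S7_a else 1) = 0"
          unfolding prod_mset_if_one nz s7_power_a_eq_0_iff using 4 by simp
      next
        fix w'
        assume w': "w' \<in> lower_words n" "set_mset w' \<subseteq> - {i}"
        then have "size (nonzero w') \<noteq> n + 2"
          using letter_in_full_word[OF _ _ i(1), of w'] unfolding lower_words_def by blast
        then have "size (nonzero w') \<le> 1"
          using w'(1) unfolding lower_words_def mem_Collect_eq by linarith
        then show "(\<Prod>x\<in>#w'. if x \<noteq> 0 then S7_a else 1) \<noteq> 0"
          unfolding prod_mset_if_one nz s7_power_a_eq_0_iff by linarith
      qed
    qed
  qed
qed

text \<open>Here \<open>u\<close> is a context, and \<open>v i\<close> and \<open>t\<close> are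
  words substituted for \<open>x_i\<close> and \<open>z\<close>; the hypotheses put the summands of
  \<open>lower_term m\<close> into \<open>W\<close>. The proof splits by the number of
  \<open>z\<close> in the result.\<close>

lemma lower_words_closed:
  assumes "m \<noteq> n"
    and single: "\<And>i. i \<in> {1..m + 2} \<Longrightarrow> u + v i \<in> lower_words n"
    and full: "u + ((\<Sum>i=1..m + 2. v i) + t) \<in> lower_words n"
    and square: "u + (t + t) \<in> lower_words n"
  shows "u + (\<Sum>i=1..m + 2. v i) \<in> lower_words n"
proof -
  define I where "I = {1..m + 2}"
  define V where "V = (\<Sum>i\<in>I. v i)"
  have I: "finite I" "1 \<in> I" "card I = m + 2" by (simp_all add: I_def)
  let ?d = "\<lambda>w. size (nonzero w)" and ?k = "\<lambda>w. count w 0"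
  have dV: "?d (u + V) = ?d u + (\<Sum>i\<in>I. ?d (v i))"
    by (simp add: nonzero_plus size_nonzero_sum V_def)
  have kV: "?k (u + V) = ?k u + (\<Sum>i\<in>I. ?k (v i))"
    by (simp add: count_sum_mset V_def)
  have full: "u + (V + t) \<in> lower_words n" using full by (simp add: V_def I_def)
  have "nonzero (u + V) + nonzero t \<subseteq># letters n"
    using full by (simp add: lower_words_def nonzero_plus add.assoc)
  then have sub: "nonzero (u + V) \<subseteq># letters n"
    by (metis mset_subset_eq_add_left subset_mset.order_trans)
  \<comment> \<open>The word \<open>t\<close> is used twice, but a word of \<open>W\<close> has no
    repeated letter other than \<open>z\<close>; so \<open>t\<close> is a power of
    \<open>z\<close>.\<close>
  have "count (nonzero t) i = 0" for i
  proof -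
    have "nonzero u + (nonzero t + nonzero t) \<subseteq># letters n"
      using square by (simp add: lower_words_def nonzero_plus)
    then have "count (nonzero u + (nonzero t + nonzero t)) i \<le> count (letters n) i"
      by (rule mset_subset_eq_count)
    then show ?thesis unfolding count_letters by (simp split: if_splits)
  qed
  then have "nonzero t = {#}" by (simp add: multiset_eq_iff)
  then have full': "?d (u + V) \<le> 1 \<or> ?d (u + V) = n + 2"
    using full by (auto simp: lower_words_def nonzero_plus)
  have single': "?d u + ?d (v i) = 1 \<and> ?k u + ?k (v i) = 0 \<or> ?k u + ?k (v i) \<ge> 2 \<or>
      ?d u + ?d (v i) = n + 2 \<and> ?k u + ?k (v i) \<ge> 1" if "i \<in> I" for i
    using single[of i] that
    unfolding lower_words_def nonzero_plus I_def mem_Collect_eq size_union count_union by blast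
  consider "?k (u + V) \<ge> 2" | "?k (u + V) = 1" | "?k (u + V) = 0" by linarith
  then have "u + V \<in> lower_words n"
  proof cases
    case 1
    then have "?d (u + V) \<le> 1 \<and> ?k (u + V) \<ge> 2 \<or> ?d (u + V) = n + 2 \<and> ?k (u + V) \<ge> 1"
      using full' by linarith
    then show ?thesis using sub unfolding lower_words_def by blast
  next
    case 2
    \<comment> \<open>The single \<open>z\<close> lies in \<open>u\<close> or in exactly one
      \<open>v i\<close>, so some \<open>u + v i\<close> contains it once. Such a word of
      \<open>W\<close> is full, and then so is \<open>u + V\<close>.\<close>
    have "\<exists>i\<in>I. ?k u + ?k (v i) = 1"
    proof (cases "?k u = 1")
      case True
      then have "(\<Sum>i\<in>I. ?k (v i)) = 0" using 2 kV by linarith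
      moreover have "?k (v 1) \<le> (\<Sum>i\<in>I. ?k (v i))" using I by (intro member_le_sum) auto
      ultimately have "?k (v 1) = 0" by linarith
      then have "?k u + ?k (v 1) = 1" using True by linarith
      then show ?thesis using I(2) by blast
    next
      case False
      then have "?k u = 0" "(\<Sum>i\<in>I. ?k (v i)) = 1" using 2 kV by linarith+
      moreover from this obtain i where "i \<in> I" "?k (v i) = 1"
        using sum_eq_1_iff[OF I(1), of "\<lambda>i. ?k (v i)"] by blast
      ultimately show ?thesis by (intro bexI[of _ i]) linarith
    qed
    then obtain i where i: "i \<in> I" "?k u + ?k (v i) = 1" by blast
    then have "?d u + ?d (v i) = n + 2" using single'[OF i(1)] by linarith
    moreover have "?d (v i) \<le> (\<Sum>i\<in>I. ?d (v i))" using i(1) I(1) by (intro member_le_sum) auto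
    ultimately have "?d (u + V) = n + 2" using dV full' by linarith
    moreover have "?k (u + V) \<ge> 1" using 2 by linarith
    ultimately show ?thesis using sub unfolding lower_words_def by blast
  next
    case 3
    have k0: "?k u = 0" using 3 kV by linarith
    have d1: "?d u + ?d (v i) = 1" if "i \<in> I" for i
    proof -
      have "?k (v i) \<le> (\<Sum>i\<in>I. ?k (v i))" using that I(1) by (intro member_le_sum) auto
      then have "?k (v i) = 0" using 3 kV by linarith
      then show ?thesis using single'[OF that] k0 by linarith
    qed
    \<comment> \<open>If \<open>u\<close> were empty, each \<open>v i\<close> would be a single
      letter and \<open>u + V\<close> would have \<open>m + 2\<close> letters, which is neither at
      most one nor \<open>n + 2\<close>.\<close>
    have "?d u = 1"
    proof (rule ccontr)
      assume "?d u \<noteq> 1"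
      then have u0: "?d u = 0" using d1[OF I(2)] by linarith
      then have "(\<Sum>i\<in>I. ?d (v i)) = (\<Sum>i\<in>I. 1)" using d1 by (intro sum.cong) auto
      then have "?d (u + V) = m + 2" using dV u0 I(3) by simp
      then show False using full' \<open>m \<noteq> n\<close> by linarith
    qed
    moreover have "(\<Sum>i\<in>I. ?d (v i)) = 0" using d1 \<open>?d u = 1\<close> by (intro sum.neutral) simp
    ultimately have "?d (u + V) = 1" using dV by linarith
    then show ?thesis using 3 sub unfolding lower_words_def by blast
  qed
  then show ?thesis by (simp add: V_def I_def)
qed

text \<open>A new summand can only shrink the set of contexts, so it remains to see that contexts of
  \<open>lower_term m\<close> are contexts of \<open>prod_term m\<close>;
  \<open>lower_words_closed\<close> gives this word by word.\<close>

lemma syntactic_semiring_satisfies_sigma: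
  assumes "m \<noteq> n"
  shows "satisfies (syntactic_semiring (lower_words n)) {sigma m}"
  unfolding satisfies_syntactic_semiring sigma_def
proof (clarify)
  fix \<psi> :: "nat \<Rightarrow> nat multiset set"
  assume "\<forall>i. \<psi> i \<noteq> {}"
  then obtain t where t: "t \<in> \<psi> 0" by blast
  have "u + w \<in> lower_words n"
    if u: "u \<in> contexts (lower_words n) (eval set_semiring \<psi> (lower_term m))"
      and w: "w \<in> eval set_semiring \<psi> (prod_term m)" for u w
  proof -
    have u': "u + x \<in> lower_words n" if "x \<in> eval set_semiring \<psi> (lower_term m)" for x
      using u that by (simp add: contexts_def)
    obtain v where v: "w = (\<Sum>i=1..m + 2. v i)" "\<And>i. i \<in> {1..m + 2} \<Longrightarrow> v i \<in> \<psi> i"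
      using w unfolding eval_prod_term by blast
    have "u + v i \<in> lower_words n" if "i \<in> {1..m + 2}" for i
      using v(2)[OF that] that by (intro u') (auto simp: eval_lower_term)
    moreover have "u + (w + t) \<in> lower_words n" "u + (t + t) \<in> lower_words n"
      using w t by (simp_all add: u' eval_lower_term set_plus_intro)
    ultimately show ?thesis
      using lower_words_closed[OF assms] v(1) by blast
  qed
  then show "contexts (lower_words n) (eval set_semiring \<psi> (Add (lower_term m) (prod_term m))) =
      contexts (lower_words n) (eval set_semiring \<psi> (lower_term m))"
    by (auto simp: set_semiring_def contexts_def)
qed

lemma nonzero_letters: "nonzero (letters n) = letters n"
  by (rule multiset_eqI) (simp add: nonzero_def count_letters)

text \<open>When each variable stands for its own letter, all summands of
  \<open>lower_term n\<close> lie in \<open>W\<close> but the product does not, so the empty context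
  distinguishes the two sides.\<close>

lemma not_satisfies_sigma: "\<not> satisfies (syntactic_semiring (lower_words n)) {sigma n}"
proof
  assume sat: "satisfies (syntactic_semiring (lower_words n)) {sigma n}"
  define \<psi> :: "nat \<Rightarrow> nat multiset set" where "\<psi> = (\<lambda>i. {{#i#}})"
  have prod: "eval set_semiring \<psi> (prod_term n) = {letters n}"
  proof -
    have "(\<Sum>i=1..n + 2. v i) = letters n" if "\<forall>i\<in>{1..n + 2}. v i \<in> \<psi> i" for v
      unfolding letters_eq_sum by (rule sum.cong) (use that in \<open>auto simp: \<psi>_def\<close>)
    then have "eval set_semiring \<psi> (prod_term n) \<subseteq> {letters n}"
      unfolding eval_prod_term by blast
    moreover have "letters n \<in> eval set_semiring \<psi> (prod_term n)"
      unfolding eval_prod_term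
      by (intro CollectI exI[of _ "\<lambda>i. {#i#}"] conjI letters_eq_sum) (simp add: \<psi>_def)
    ultimately show ?thesis by blast
  qed
  have "{#i#} \<in> lower_words n" if "i \<in> {1..n + 2}" for i
    using that by (auto simp: lower_words_def nonzero_def letters_def)
  moreover have "letters n + {#0#} \<in> lower_words n"
  proof -
    have "nonzero (letters n + {#0#}) = letters n"
      unfolding nonzero_plus nonzero_letters by (simp add: nonzero_def)
    then show ?thesis by (simp add: lower_words_def size_letters)
  qed
  moreover have "{#0, 0#} \<in> lower_words n"
    by (simp add: lower_words_def nonzero_def)
  ultimately have "eval set_semiring \<psi> (lower_term n) \<subseteq> lower_words n"
    unfolding eval_lower_term prod by (auto simp: \<psi>_def set_plus_def)
  then have "{#} \<in> contexts (lower_words n) (eval set_semiring \<psi> (lower_term n))"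
    by (auto simp: contexts_def)
  also have "\<dots> = contexts (lower_words n) (eval set_semiring \<psi> (Add (lower_term n) (prod_term n)))"
    using sat unfolding satisfies_syntactic_semiring sigma_def by (auto simp: \<psi>_def)
  finally have "letters n \<in> lower_words n"
    using prod by (simp add: set_semiring_def contexts_def)
  moreover have "0 \<notin># letters n" by (simp add: letters_def)
  ultimately show False by (simp add: lower_words_def nonzero_letters size_letters)
qed

section \<open>The interval\<close>

text \<open>There are countably many identities, so a set of naturals can code the axioms of any
  variety.\<close>

lemma varieties_lepoll: "{\<V> :: 'u ais set. variety \<V>} \<lesssim> (UNIV :: nat set set)"
proof -
  have "{\<V> :: 'u ais set. variety \<V>} \<subseteq> (\<lambda>X. variety_of (to_nat -` X)) ` (UNIV :: nat set set)"
  proof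
    fix \<V> :: "'u ais set"
    assume "\<V> \<in> {\<V>. variety \<V>}"
    then obtain \<Sigma> where "\<V> = variety_of \<Sigma>" by (auto simp: variety_def)
    moreover have "to_nat -` (to_nat ` \<Sigma>) = \<Sigma>" by (simp add: inj_vimage_image_eq)
    ultimately show "\<V> \<in> (\<lambda>X. variety_of (to_nat -` X)) ` (UNIV :: nat set set)"
      by (metis UNIV_I image_eqI)
  qed
  then show ?thesis by (meson image_lepoll lepoll_trans subset_imp_lepoll)
qed

lemma satisfies_nonempty_power_semiring:
  assumes "satisfies (power_semiring :: 's::semigroup_mult set ais) \<Sigma>"
  shows "satisfies (nonempty_power_semiring :: 's set ais) \<Sigma>"
proof -
  have "eval (nonempty_power_semiring :: 's set ais) \<phi> t = eval power_semiring \<phi> t" for \<phi> t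
    by (induction t) (simp_all add: nonempty_power_semiring_def power_semiring_def)
  then show ?thesis using assms by (auto simp: satisfies_def power_semiring_def)
qed

lemma satisfies_Un_image:
  "satisfies S (\<Sigma> \<union> f ` A) \<longleftrightarrow> satisfies S \<Sigma> \<and> (\<forall>n\<in>A. satisfies S {f n})"
  unfolding satisfies_def ball_Un by simp

theorem theorem5p2:
  assumes "infinite (UNIV :: 'u set)"
  shows "(variety_interval
            (generated_variety (nonempty_power_semiring :: s7 set ais))
            (generated_variety (power_semiring :: s7 set ais)) :: 'u ais set set)
         \<approx> (UNIV :: nat set set)"
    (is "?I \<approx> _")
proof (rule lepoll_antisym)
  have "?I \<subseteq> {\<V>. variety \<V>}" by (auto simp: variety_interval_def)
  then show "?I \<lesssim> (UNIV :: nat set set)"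
    using varieties_lepoll lepoll_trans subset_imp_lepoll by blast
next
  define \<Sigma> where "\<Sigma> = \<Union> {\<Sigma>. satisfies (power_semiring :: s7 set ais) \<Sigma>}"
  define \<V> where "\<V> = (\<lambda>A. variety_of (\<Sigma> \<union> sigma ` A) :: 'u ais set)"
  have sat: "satisfies (power_semiring :: s7 set ais) \<Sigma>"
    by (simp add: \<Sigma>_def satisfies_Union)
  have "\<V> A \<in> ?I" for A
  proof -
    have "satisfies (nonempty_power_semiring :: s7 set ais) (\<Sigma> \<union> sigma ` A)"
      unfolding satisfies_Un_image
      using satisfies_nonempty_power_semiring[OF sat] nonempty_power_semiring_satisfies_sigma
      by blast
    then have "generated_variety (nonempty_power_semiring :: s7 set ais) \<subseteq> \<V> A"
      unfolding generated_variety_def \<V>_def by (intro Inter_lower) blast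
    moreover have "\<V> A \<subseteq> generated_variety (power_semiring :: s7 set ais)"
      unfolding generated_variety_eq \<V>_def \<Sigma>_def[symmetric] variety_of_def satisfies_Un_image
      by blast
    moreover have "variety (\<V> A)" unfolding variety_def \<V>_def by blast
    ultimately show ?thesis by (simp add: variety_interval_def)
  qed
  moreover have "A \<subseteq> B" if eq: "\<V> B \<subseteq> \<V> A" for A B
  proof (rule ccontr)
    assume "\<not> A \<subseteq> B"
    then obtain n where n: "n \<in> A" "n \<notin> B" by blast
    \<comment> \<open>This semiring satisfies the axioms of \<open>\<V> B\<close> but not
      \<open>sigma n\<close>, which is an axiom of \<open>\<V> A\<close>.\<close>
    let ?T = "syntactic_semiring (lower_words n)"
    have "satisfies ?T \<Sigma>"
      using syntactic_semiring_satisfies_power_identities[OF lower_words_separated sat] .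
    moreover have "satisfies ?T {sigma m}" if "m \<in> B" for m
      using that n(2) by (intro syntactic_semiring_satisfies_sigma) auto
    ultimately have "satisfies ?T (\<Sigma> \<union> sigma ` B)"
      unfolding satisfies_Un_image by blast
    \<comment> \<open>The elements of \<open>?T\<close> are sets of multisets rather than members of
      \<open>'u\<close>, so the inclusion of varieties has to be transferred to another
      type.\<close>
    then have "satisfies ?T (\<Sigma> \<union> sigma ` A)"
      using variety_of_subsetD[OF assms eq[unfolded \<V>_def] ai_semiring_syntactic_semiring] by blast
    then have "satisfies ?T {sigma n}" using n(1) unfolding satisfies_Un_image by blast
    then show False using not_satisfies_sigma by blast
  qed
  then have "inj \<V>" by (intro injI) blast
  ultimately show "(UNIV :: nat set set) \<lesssim> ?I" unfolding lepoll_def by blast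
qed

end
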